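(* In the setting below, if $\gamma$ is a proper generalizer, then $\mathrm{GCG}_{\simeq}(\Phi,\psi,\overset{\simeq}{\gamma})$ maintains Properties 1 and 2, and maintains Property 3 (for the generalizer $\overset{\simeq}{\gamma}$) as an invariant.
   Context: LTS setting. A labeled transition system (LTS) is $\langle\Sigma,Q,Q_0,\Delta\rangle$ (finite labels $\Sigma$, finite states $Q$, initial states $Q_0\subseteq Q$, $\Delta\subseteq Q\times\Sigma\times Q$). Fix an LTS $M_0=\langle\Sigma,Q,Q_0,\Delta_0\rangle$; a completion of $M_0$ is an LTS with the same $\Sigma,Q,Q_0$ and transition relation $\Delta\supseteq\Delta_0$. Let $V=\{x_{p,a,q}: p,q\in Q, a\in\Sigma\}$; an assignment $\sigma:V\to\{0,1\}$ encodes the LTS $M_\sigma$ with $\Sigma,Q,Q_0$ and $\Delta_\sigma=\{(p,a,q):\sigma(x_{p,a,q})=1\}$. $\Phi$ is a propositional formula over $V$ that implies $\bigwedge_{(p,a,q)\in\Delta_0}x_{p,a,q}$. Let $A$ be the set of non-initial states of $M_0$ with no incoming or outgoing transitions in $\Delta_0$. For assignments $\sigma,\rho$ satisfying $\Phi$, $\sigma\simeq\rho$ means there is a bijection $f:Q\to Q$ with $f(q)=q$ for $q\notin A$ such that $(p,a,q)\in\Delta_\sigma$ iff $(f(p),a,f(q))\in\Delta_\rho$. For $\rho\models\Phi$, $[\rho]=\{\sigma:\sigma\models\Phi,\ \sigma\simeq\rho\}$, also viewed as the formula satisfied exactly by its elements. $\psi$ is a specification with satisfaction relation $M\models\psi$,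 assumed invariant under isomorphism: if $\sigma\simeq\rho$ then $M_\sigma\models\psi$ iff $M_\rho\models\psi$. A generalizer maps assignments to formulas over $V$; $\gamma$ is proper if for every $\sigma\models\Phi$ with $M_\sigma\not\models\psi$: $\sigma\models\gamma(\sigma)$, and no $\rho$ with $\rho\models\Phi$, $M_\rho\models\psi$ satisfies $\gamma(\sigma)$. The equivalence closure of $\gamma$ is $\overset{\simeq}{\gamma}(\rho):=\bigvee_{\sigma\in[\rho]}\gamma(\sigma)$. Algorithm $\mathrm{GCG}_{\simeq}(\Phi,\psi,g)$ for a generalizer $g$: keep $\Phi_{cur}:=\Phi$; while $\Phi_{cur}$ is satisfiable, pick an arbitrary $\sigma\models\Phi_{cur}$ (a candidate); if $M_\sigma\models\psi$, output $\sigma$ (a solution) and set $\Phi_{cur}:=\Phi_{cur}\wedge\neg[\sigma]$; else set $\Phi_{cur}:=\Phi_{cur}\wedge\neg g(\sigma)$. In an execution, $\mathsf{Cand}$ and $\mathsf{Sol}$ are the sets of candidates and solutions, and at any point $\mathsf{Pruned}$ is the set of all assignments satisfying some formula $\varphi$ for which a step $\Phi_{cur}:=\Phi_{cur}\wedge\neg\varphi$ has been performed so far. Property 1: for every terminated execution and every $\sigma\models\Phi$, $[\sigma]\cap\mathsf{Sol}$ has at most one element. Property 2: for every terminated execution and every $\sigma\models\Phi$, $[\sigma]\cap\mathsf{Cand}$ has at most one element. Property 3 (invariant, for generalizer $g$): in every execution, at every point, for every $\sigma$ for which the step $\Phi_{cur}:=\Phi_{cur}\wedge\neg g(\sigma)$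 has been performed so far and every $\rho\simeq\sigma$, every assignment satisfying $g(\rho)$ belongs to $\mathsf{Pruned}$. *)

theory Defs
  imports Main "HOL-Library.FuncSet"
begin

record ('q, 'a) lts =
  labels :: "'a set"
  states :: "'q set"
  initial :: "'q set"
  transitions :: "('q \<times> 'a \<times> 'q) set"

definition is_lts :: "('q, 'a) lts \<Rightarrow> bool" where
  "is_lts M \<longleftrightarrow> finite (labels M) \<and> finite (states M) \<and> initial M \<subseteq> states M \<and>
     transitions M \<subseteq> states M \<times> labels M \<times> states M"

datatype (vars: 'v) form =
  Falsum
| Atom 'v
| Neg "'v form"
| Conj "'v form" "'v form"
| Disj "'v form" "'v form"

primrec holds :: "('v \<Rightarrow> bool) \<Rightarrow> 'v form \<Rightarrow> bool" where
  "holds \<sigma> Falsum \<longleftrightarrow> False"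
| "holds \<sigma> (Atom v) \<longleftrightarrow> \<sigma> v"
| "holds \<sigma> (Neg \<phi>) \<longleftrightarrow> \<not> holds \<sigma> \<phi>"
| "holds \<sigma> (Conj \<phi> \<chi>) \<longleftrightarrow> holds \<sigma> \<phi> \<and> holds \<sigma> \<chi>"
| "holds \<sigma> (Disj \<phi> \<chi>) \<longleftrightarrow> holds \<sigma> \<phi> \<or> holds \<sigma> \<chi>"

text \<open>Conjunction and disjunction of a finite set of formulas, in an arbitrary order.\<close>

definition big_conj :: "'v form set \<Rightarrow> 'v form" where
  "big_conj F = foldr Conj (SOME \<phi>s. set \<phi>s = F) (Neg Falsum)"

definition big_disj :: "'v form set \<Rightarrow> 'v form" where
  "big_disj F = foldr Disj (SOME \<phi>s. set \<phi>s = F) Falsum"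

text \<open>The variable \<open>x\<^sub>p\<^sub>,\<^sub>a\<^sub>,\<^sub>q\<close> is represented by the triple \<open>(p, a, q)\<close>. Assignments are
  extensional functions, so that two assignments are equal iff they agree on all variables.\<close>

type_synonym ('q, 'a) var = "'q \<times> 'a \<times> 'q"
type_synonym ('q, 'a) assignment = "('q, 'a) var \<Rightarrow> bool"

definition variables :: "('q, 'a) lts \<Rightarrow> ('q, 'a) var set" where
  "variables M\<^sub>0 = states M\<^sub>0 \<times> labels M\<^sub>0 \<times> states M\<^sub>0"

definition assignments :: "('q, 'a) lts \<Rightarrow> ('q, 'a) assignment set" where
  "assignments M\<^sub>0 = variables M\<^sub>0 \<rightarrow>\<^sub>E UNIV"

definition decode :: "('q, 'a) lts \<Rightarrow> ('q, 'a) assignment \<Rightarrow> ('q, 'a) lts" where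
  "decode M\<^sub>0 \<sigma> = \<lparr>labels = labels M\<^sub>0, states = states M\<^sub>0, initial = initial M\<^sub>0,
     transitions = {t \<in> variables M\<^sub>0. \<sigma> t}\<rparr>"

definition models_of :: "('q, 'a) lts \<Rightarrow> ('q, 'a) var form \<Rightarrow> ('q, 'a) assignment set" where
  "models_of M\<^sub>0 \<phi> = {\<sigma> \<in> assignments M\<^sub>0. holds \<sigma> \<phi>}"

definition isolated :: "('q, 'a) lts \<Rightarrow> 'q set" where
  "isolated M\<^sub>0 = {q \<in> states M\<^sub>0 - initial M\<^sub>0.
     \<forall>(p, a, r) \<in> transitions M\<^sub>0. p \<noteq> q \<and> r \<noteq> q}"

definition assign_equiv ::
  "('q, 'a) lts \<Rightarrow> ('q, 'a) var form \<Rightarrow> ('q, 'a) assignment \<Rightarrow> ('q, 'a) assignment \<Rightarrow> bool" where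
  "assign_equiv M\<^sub>0 \<Phi> \<sigma> \<rho> \<longleftrightarrow> \<sigma> \<in> models_of M\<^sub>0 \<Phi> \<and> \<rho> \<in> models_of M\<^sub>0 \<Phi> \<and>
     (\<exists>f. bij_betw f (states M\<^sub>0) (states M\<^sub>0) \<and>
          (\<forall>q \<in> states M\<^sub>0 - isolated M\<^sub>0. f q = q) \<and>
          (\<forall>p \<in> states M\<^sub>0. \<forall>a \<in> labels M\<^sub>0. \<forall>q \<in> states M\<^sub>0.
             (p, a, q) \<in> transitions (decode M\<^sub>0 \<sigma>) \<longleftrightarrow>
             (f p, a, f q) \<in> transitions (decode M\<^sub>0 \<rho>)))"

definition equiv_class ::
  "('q, 'a) lts \<Rightarrow> ('q, 'a) var form \<Rightarrow> ('q, 'a) assignment \<Rightarrow> ('q, 'a) assignment set" where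
  "equiv_class M\<^sub>0 \<Phi> \<rho> = {\<sigma>. assign_equiv M\<^sub>0 \<Phi> \<sigma> \<rho>}"

definition minterm :: "('q, 'a) lts \<Rightarrow> ('q, 'a) assignment \<Rightarrow> ('q, 'a) var form" where
  "minterm M\<^sub>0 \<sigma> = big_conj ((\<lambda>v. if \<sigma> v then Atom v else Neg (Atom v)) ` variables M\<^sub>0)"

text \<open>The class of \<open>\<rho>\<close> as a formula, in disjunctive normal form; lemma \<open>models_of_class_form\<close>
  below shows that its models are exactly the elements of the class.\<close>

definition class_form ::
  "('q, 'a) lts \<Rightarrow> ('q, 'a) var form \<Rightarrow> ('q, 'a) assignment \<Rightarrow> ('q, 'a) var form" where
  "class_form M\<^sub>0 \<Phi> \<rho> = big_disj (minterm M\<^sub>0 ` equiv_class M\<^sub>0 \<Phi> \<rho>)"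

type_synonym ('q, 'a) generalizer = "('q, 'a) assignment \<Rightarrow> ('q, 'a) var form"

definition is_generalizer :: "('q, 'a) lts \<Rightarrow> ('q, 'a) generalizer \<Rightarrow> bool" where
  "is_generalizer M\<^sub>0 \<gamma> \<longleftrightarrow> (\<forall>\<sigma> \<in> assignments M\<^sub>0. vars (\<gamma> \<sigma>) \<subseteq> variables M\<^sub>0)"

text \<open>Here and below, \<open>sat M \<psi>\<close> is the satisfaction relation between systems and specifications.\<close>

definition proper ::
  "('q, 'a) lts \<Rightarrow> ('q, 'a) var form \<Rightarrow> (('q, 'a) lts \<Rightarrow> 's \<Rightarrow> bool) \<Rightarrow> 's \<Rightarrow>
   ('q, 'a) generalizer \<Rightarrow> bool" where
  "proper M\<^sub>0 \<Phi> sat \<psi> \<gamma> \<longleftrightarrow>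
     (\<forall>\<sigma> \<in> models_of M\<^sub>0 \<Phi>. \<not> sat (decode M\<^sub>0 \<sigma>) \<psi> \<longrightarrow>
        holds \<sigma> (\<gamma> \<sigma>) \<and>
        \<not> (\<exists>\<rho> \<in> models_of M\<^sub>0 \<Phi>. sat (decode M\<^sub>0 \<rho>) \<psi> \<and> holds \<rho> (\<gamma> \<sigma>)))"

definition equiv_closure ::
  "('q, 'a) lts \<Rightarrow> ('q, 'a) var form \<Rightarrow> ('q, 'a) generalizer \<Rightarrow> ('q, 'a) generalizer" where
  "equiv_closure M\<^sub>0 \<Phi> \<gamma> \<rho> = big_disj (\<gamma> ` equiv_class M\<^sub>0 \<Phi> \<rho>)"

text \<open>A configuration is a point of an execution: \<open>current\<close> is \<open>\<Phi>\<^sub>c\<^sub>u\<^sub>r\<close>, \<open>pending\<close> is the candidate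
  picked in an unfinished loop iteration, and the other components record the history: the
  candidates and solutions so far, the candidates \<open>\<sigma>\<close> for which \<open>\<Phi>\<^sub>c\<^sub>u\<^sub>r := \<Phi>\<^sub>c\<^sub>u\<^sub>r \<and> \<not> g(\<sigma>)\<close> has been
  performed, and all \<open>\<phi>\<close> for which a step \<open>\<Phi>\<^sub>c\<^sub>u\<^sub>r := \<Phi>\<^sub>c\<^sub>u\<^sub>r \<and> \<not> \<phi>\<close> has been performed.\<close>

record ('q, 'a) config =
  current :: "('q, 'a) var form"
  pending :: "('q, 'a) assignment option"
  cand :: "('q, 'a) assignment set"
  sol :: "('q, 'a) assignment set"
  generalized :: "('q, 'a) assignment set"
  excluded :: "('q, 'a) var form set"

text \<open>The configurations occurring in executions of the algorithm with generalizer \<open>g\<close>.\<close>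

inductive gcg ::
  "('q, 'a) lts \<Rightarrow> ('q, 'a) var form \<Rightarrow> (('q, 'a) lts \<Rightarrow> 's \<Rightarrow> bool) \<Rightarrow> 's \<Rightarrow>
   ('q, 'a) generalizer \<Rightarrow> ('q, 'a) config \<Rightarrow> bool"
  for M\<^sub>0 \<Phi> sat \<psi> g where
  start: "gcg M\<^sub>0 \<Phi> sat \<psi> g
    \<lparr>current = \<Phi>, pending = None, cand = {}, sol = {}, generalized = {}, excluded = {}\<rparr>"
| pick: "\<lbrakk>gcg M\<^sub>0 \<Phi> sat \<psi> g c; pending c = None; \<sigma> \<in> models_of M\<^sub>0 (current c)\<rbrakk> \<Longrightarrow>
    gcg M\<^sub>0 \<Phi> sat \<psi> g (c\<lparr>pending := Some \<sigma>, cand := insert \<sigma> (cand c)\<rparr>)"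
| accept: "\<lbrakk>gcg M\<^sub>0 \<Phi> sat \<psi> g c; pending c = Some \<sigma>; sat (decode M\<^sub>0 \<sigma>) \<psi>\<rbrakk> \<Longrightarrow>
    gcg M\<^sub>0 \<Phi> sat \<psi> g
      (c\<lparr>current := Conj (current c) (Neg (class_form M\<^sub>0 \<Phi> \<sigma>)), pending := None,
         sol := insert \<sigma> (sol c),
         excluded := insert (class_form M\<^sub>0 \<Phi> \<sigma>) (excluded c)\<rparr>)"
| reject: "\<lbrakk>gcg M\<^sub>0 \<Phi> sat \<psi> g c; pending c = Some \<sigma>; \<not> sat (decode M\<^sub>0 \<sigma>) \<psi>\<rbrakk> \<Longrightarrow>
    gcg M\<^sub>0 \<Phi> sat \<psi> g
      (c\<lparr>current := Conj (current c) (Neg (g \<sigma>)), pending := None,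
         generalized := insert \<sigma> (generalized c),
         excluded := insert (g \<sigma>) (excluded c)\<rparr>)"

definition terminated :: "('q, 'a) lts \<Rightarrow> ('q, 'a) config \<Rightarrow> bool" where
  "terminated M\<^sub>0 c \<longleftrightarrow> pending c = None \<and> models_of M\<^sub>0 (current c) = {}"

definition pruned :: "('q, 'a) lts \<Rightarrow> ('q, 'a) config \<Rightarrow> ('q, 'a) assignment set" where
  "pruned M\<^sub>0 c = (\<Union>\<phi> \<in> excluded c. models_of M\<^sub>0 \<phi>)"

definition one_solution_per_class ::
  "('q, 'a) lts \<Rightarrow> ('q, 'a) var form \<Rightarrow> (('q, 'a) lts \<Rightarrow> 's \<Rightarrow> bool) \<Rightarrow> 's \<Rightarrow>
   ('q, 'a) generalizer \<Rightarrow> bool" where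
  "one_solution_per_class M\<^sub>0 \<Phi> sat \<psi> g \<longleftrightarrow>
     (\<forall>c. gcg M\<^sub>0 \<Phi> sat \<psi> g c \<and> terminated M\<^sub>0 c \<longrightarrow>
        (\<forall>\<sigma> \<in> models_of M\<^sub>0 \<Phi>. \<exists>\<^sub>\<le>\<^sub>1 \<tau>. \<tau> \<in> equiv_class M\<^sub>0 \<Phi> \<sigma> \<inter> sol c))"

definition one_candidate_per_class ::
  "('q, 'a) lts \<Rightarrow> ('q, 'a) var form \<Rightarrow> (('q, 'a) lts \<Rightarrow> 's \<Rightarrow> bool) \<Rightarrow> 's \<Rightarrow>
   ('q, 'a) generalizer \<Rightarrow> bool" where
  "one_candidate_per_class M\<^sub>0 \<Phi> sat \<psi> g \<longleftrightarrow>
     (\<forall>c. gcg M\<^sub>0 \<Phi> sat \<psi> g c \<and> terminated M\<^sub>0 c \<longrightarrow>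
        (\<forall>\<sigma> \<in> models_of M\<^sub>0 \<Phi>. \<exists>\<^sub>\<le>\<^sub>1 \<tau>. \<tau> \<in> equiv_class M\<^sub>0 \<Phi> \<sigma> \<inter> cand c))"

definition generalizations_pruned ::
  "('q, 'a) lts \<Rightarrow> ('q, 'a) var form \<Rightarrow> (('q, 'a) lts \<Rightarrow> 's \<Rightarrow> bool) \<Rightarrow> 's \<Rightarrow>
   ('q, 'a) generalizer \<Rightarrow> bool" where
  "generalizations_pruned M\<^sub>0 \<Phi> sat \<psi> g \<longleftrightarrow>
     (\<forall>c. gcg M\<^sub>0 \<Phi> sat \<psi> g c \<longrightarrow>
        (\<forall>\<sigma> \<in> generalized c. \<forall>\<rho>. assign_equiv M\<^sub>0 \<Phi> \<rho> \<sigma> \<longrightarrow>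
           models_of M\<^sub>0 (g \<rho>) \<subseteq> pruned M\<^sub>0 c))"

lemma holds_big_conj:
  assumes "finite F"
  shows "holds \<sigma> (big_conj F) \<longleftrightarrow> (\<forall>\<phi> \<in> F. holds \<sigma> \<phi>)"
proof -
  have "holds \<sigma> (foldr Conj \<phi>s (Neg Falsum)) \<longleftrightarrow> (\<forall>\<phi> \<in> set \<phi>s. holds \<sigma> \<phi>)" for \<phi>s
    by (induction \<phi>s) auto
  moreover have "set (SOME \<phi>s. set \<phi>s = F) = F"
    using finite_list[OF assms] by (rule someI_ex)
  ultimately show ?thesis by (simp add: big_conj_def)
qed

lemma holds_big_disj:
  assumes "finite F"
  shows "holds \<sigma> (big_disj F) \<longleftrightarrow> (\<exists>\<phi> \<in> F. holds \<sigma> \<phi>)"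
proof -
  have "holds \<sigma> (foldr Disj \<phi>s Falsum) \<longleftrightarrow> (\<exists>\<phi> \<in> set \<phi>s. holds \<sigma> \<phi>)" for \<phi>s
    by (induction \<phi>s) auto
  moreover have "set (SOME \<phi>s. set \<phi>s = F) = F"
    using finite_list[OF assms] by (rule someI_ex)
  ultimately show ?thesis by (simp add: big_disj_def)
qed

lemma finite_variables: "is_lts M\<^sub>0 \<Longrightarrow> finite (variables M\<^sub>0)"
  by (simp add: is_lts_def variables_def)

lemma equiv_class_subset: "equiv_class M\<^sub>0 \<Phi> \<rho> \<subseteq> models_of M\<^sub>0 \<Phi>"
  by (auto simp: equiv_class_def assign_equiv_def)

lemma finite_equiv_class:
  assumes "is_lts M\<^sub>0"
  shows "finite (equiv_class M\<^sub>0 \<Phi> \<rho>)"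
proof (rule finite_subset)
  show "equiv_class M\<^sub>0 \<Phi> \<rho> \<subseteq> assignments M\<^sub>0"
    using equiv_class_subset[of M\<^sub>0 \<Phi> \<rho>] unfolding models_of_def by blast
  show "finite (assignments M\<^sub>0)"
    unfolding assignments_def using finite_variables[OF assms] by (intro finite_PiE) auto
qed

lemma holds_minterm:
  assumes "is_lts M\<^sub>0" "\<sigma> \<in> assignments M\<^sub>0" "\<tau> \<in> assignments M\<^sub>0"
  shows "holds \<tau> (minterm M\<^sub>0 \<sigma>) \<longleftrightarrow> \<tau> = \<sigma>"
proof -
  have "holds \<tau> (minterm M\<^sub>0 \<sigma>) \<longleftrightarrow> (\<forall>v \<in> variables M\<^sub>0. \<tau> v = \<sigma> v)"
  proof -
    have "holds \<tau> (minterm M\<^sub>0 \<sigma>) \<longleftrightarrow>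
        (\<forall>v \<in> variables M\<^sub>0. holds \<tau> (if \<sigma> v then Atom v else Neg (Atom v)))"
      unfolding minterm_def holds_big_conj[OF finite_imageI[OF finite_variables[OF assms(1)]]]
      by (rule ball_simps(9))
    also have "\<dots> \<longleftrightarrow> (\<forall>v \<in> variables M\<^sub>0. \<tau> v = \<sigma> v)"
      by (intro ball_cong refl) (simp split: if_split)
    finally show ?thesis .
  qed
  also have "\<dots> \<longleftrightarrow> \<tau> = \<sigma>"
    using PiE_ext[OF assms(3)[unfolded assignments_def] assms(2)[unfolded assignments_def]] by blast
  finally show ?thesis .
qed

lemma models_of_class_form:
  assumes "is_lts M\<^sub>0"
  shows "models_of M\<^sub>0 (class_form M\<^sub>0 \<Phi> \<rho>) = equiv_class M\<^sub>0 \<Phi> \<rho>"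
proof -
  have sub: "equiv_class M\<^sub>0 \<Phi> \<rho> \<subseteq> assignments M\<^sub>0"
    using equiv_class_subset[of M\<^sub>0 \<Phi> \<rho>] unfolding models_of_def by blast
  have "holds \<tau> (class_form M\<^sub>0 \<Phi> \<rho>) \<longleftrightarrow> (\<exists>\<sigma> \<in> equiv_class M\<^sub>0 \<Phi> \<rho>. holds \<tau> (minterm M\<^sub>0 \<sigma>))" for \<tau>
    unfolding class_form_def holds_big_disj[OF finite_imageI[OF finite_equiv_class[OF assms]]]
    by (rule bex_simps(7))
  moreover have "holds \<tau> (minterm M\<^sub>0 \<sigma>) \<longleftrightarrow> \<tau> = \<sigma>"
    if "\<sigma> \<in> equiv_class M\<^sub>0 \<Phi> \<rho>" "\<tau> \<in> assignments M\<^sub>0" for \<sigma> \<tau>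
    using holds_minterm[OF assms] that sub by blast
  ultimately show ?thesis
    unfolding models_of_def using sub by blast
qed

lemma holds_equiv_closure:
  assumes "is_lts M\<^sub>0"
  shows "holds \<tau> (equiv_closure M\<^sub>0 \<Phi> \<gamma> \<rho>) \<longleftrightarrow> (\<exists>\<sigma> \<in> equiv_class M\<^sub>0 \<Phi> \<rho>. holds \<tau> (\<gamma> \<sigma>))"
  using assms by (simp add: equiv_closure_def holds_big_disj finite_equiv_class)

end

theory Submission imports Defs begin

text \<open>Processing a candidate \<open>\<sigma>\<close> removes all of \<open>[\<sigma>]\<close> from \<open>\<Phi>\<^sub>c\<^sub>u\<^sub>r\<close>. For a solution this is
  explicit; otherwise every \<open>\<rho> \<in> [\<sigma>]\<close> also violates \<open>\<psi>\<close> by invariance, so properness gives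
  \<open>\<rho> \<Turnstile> \<gamma>(\<rho>)\<close>, and \<open>\<gamma>(\<rho>)\<close> is a disjunct of the closure at \<open>\<sigma>\<close>. Hence no later candidate
  is equivalent to \<open>\<sigma>\<close>. Property 3 holds because the closure is constant on each class.\<close>

lemma assign_equiv_sym:
  assumes "assign_equiv M\<^sub>0 \<Phi> \<sigma> \<rho>"
  shows "assign_equiv M\<^sub>0 \<Phi> \<rho> \<sigma>"
proof -
  let ?Q = "states M\<^sub>0"
  obtain f where f: "bij_betw f ?Q ?Q" "\<forall>q \<in> ?Q - isolated M\<^sub>0. f q = q"
    and iso: "\<forall>p \<in> ?Q. \<forall>a \<in> labels M\<^sub>0. \<forall>q \<in> ?Q.
      (p, a, q) \<in> transitions (decode M\<^sub>0 \<sigma>) \<longleftrightarrow> (f p, a, f q) \<in> transitions (decode M\<^sub>0 \<rho>)"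
    using assms unfolding assign_equiv_def by blast
  let ?g = "inv_into ?Q f"
  have g: "bij_betw ?g ?Q ?Q"
    using f(1) by (rule bij_betw_inv_into)
  have fg: "?g q \<in> ?Q" "f (?g q) = q" if "q \<in> ?Q" for q
    using that g f(1) by (auto simp: bij_betw_inv_into_right dest: bij_betwE)
  \<comment> \<open>A state fixed by \<open>f\<close> is fixed by its inverse:
    \<open>?g q = ?g (f q) = q\<close>.\<close>
  have "\<forall>q \<in> ?Q - isolated M\<^sub>0. ?g q = q"
    using f bij_betw_inv_into_left[OF f(1)] by force
  \<comment> \<open>This is \<open>iso\<close> at the preimages \<open>?g p\<close> and
    \<open>?g q\<close>, with \<open>f\<close> cancelled by \<open>fg\<close>.\<close>
  moreover have "\<forall>p \<in> ?Q. \<forall>a \<in> labels M\<^sub>0. \<forall>q \<in> ?Q.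
      (p, a, q) \<in> transitions (decode M\<^sub>0 \<rho>) \<longleftrightarrow> (?g p, a, ?g q) \<in> transitions (decode M\<^sub>0 \<sigma>)"
    using iso fg by simp
  ultimately show ?thesis
    using g assms unfolding assign_equiv_def by blast
qed

lemma assign_equiv_trans:
  assumes "assign_equiv M\<^sub>0 \<Phi> \<sigma> \<rho>" "assign_equiv M\<^sub>0 \<Phi> \<rho> \<tau>"
  shows "assign_equiv M\<^sub>0 \<Phi> \<sigma> \<tau>"
proof -
  let ?Q = "states M\<^sub>0"
  obtain f where f: "bij_betw f ?Q ?Q" "\<forall>q \<in> ?Q - isolated M\<^sub>0. f q = q"
    and f_iso: "\<forall>p \<in> ?Q. \<forall>a \<in> labels M\<^sub>0. \<forall>q \<in> ?Q.
      (p, a, q) \<in> transitions (decode M\<^sub>0 \<sigma>) \<longleftrightarrow> (f p, a, f q) \<in> transitions (decode M\<^sub>0 \<rho>)"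
    using assms(1) unfolding assign_equiv_def by blast
  obtain g where g: "bij_betw g ?Q ?Q" "\<forall>q \<in> ?Q - isolated M\<^sub>0. g q = q"
    and g_iso: "\<forall>p \<in> ?Q. \<forall>a \<in> labels M\<^sub>0. \<forall>q \<in> ?Q.
      (p, a, q) \<in> transitions (decode M\<^sub>0 \<rho>) \<longleftrightarrow> (g p, a, g q) \<in> transitions (decode M\<^sub>0 \<tau>)"
    using assms(2) unfolding assign_equiv_def by blast
  have "bij_betw (g \<circ> f) ?Q ?Q"
    using f(1) g(1) by (rule bij_betw_trans)
  moreover have "\<forall>q \<in> ?Q - isolated M\<^sub>0. (g \<circ> f) q = q"
    using f(2) g(2) by simp
  moreover have "\<forall>p \<in> ?Q. \<forall>a \<in> labels M\<^sub>0. \<forall>q \<in> ?Q.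
      (p, a, q) \<in> transitions (decode M\<^sub>0 \<sigma>) \<longleftrightarrow>
      ((g \<circ> f) p, a, (g \<circ> f) q) \<in> transitions (decode M\<^sub>0 \<tau>)"
    using f_iso g_iso bij_betwE[OF f(1)] by simp
  ultimately show ?thesis
    using assms unfolding assign_equiv_def by blast
qed

lemma equiv_class_eq:
  assumes "assign_equiv M\<^sub>0 \<Phi> \<sigma> \<rho>"
  shows "equiv_class M\<^sub>0 \<Phi> \<sigma> = equiv_class M\<^sub>0 \<Phi> \<rho>"
  using assms assign_equiv_sym assign_equiv_trans unfolding equiv_class_def by blast

text \<open>The closure depends on its argument only through the class. The equality is syntactic,
  since \<open>big_disj\<close> chooses its order from the set of disjuncts alone.\<close>

lemma equiv_closure_cong:
  "assign_equiv M\<^sub>0 \<Phi> \<sigma> \<rho> \<Longrightarrow> equiv_closure M\<^sub>0 \<Phi> \<gamma> \<sigma> = equiv_closure M\<^sub>0 \<Phi> \<gamma> \<rho>"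
  by (simp add: equiv_closure_def equiv_class_eq)

lemma equiv_class_subset_equiv_closure:
  assumes "is_lts M\<^sub>0"
    and "\<forall>\<sigma> \<rho>. assign_equiv M\<^sub>0 \<Phi> \<sigma> \<rho> \<longrightarrow>
           (sat (decode M\<^sub>0 \<sigma>) \<psi> \<longleftrightarrow> sat (decode M\<^sub>0 \<rho>) \<psi>)"
    and "proper M\<^sub>0 \<Phi> sat \<psi> \<gamma>"
    and "\<not> sat (decode M\<^sub>0 \<sigma>) \<psi>"
  shows "equiv_class M\<^sub>0 \<Phi> \<sigma> \<subseteq> models_of M\<^sub>0 (equiv_closure M\<^sub>0 \<Phi> \<gamma> \<sigma>)"
proof
  fix \<rho> assume \<rho>: "\<rho> \<in> equiv_class M\<^sub>0 \<Phi> \<sigma>"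
  then have "assign_equiv M\<^sub>0 \<Phi> \<rho> \<sigma>" and model: "\<rho> \<in> models_of M\<^sub>0 \<Phi>"
    by (auto simp: equiv_class_def assign_equiv_def)
  then have "\<not> sat (decode M\<^sub>0 \<rho>) \<psi>"
    using assms(2,4) by blast
  then have "holds \<rho> (\<gamma> \<rho>)"
    using assms(3) model unfolding proper_def by blast
  then show "\<rho> \<in> models_of M\<^sub>0 (equiv_closure M\<^sub>0 \<Phi> \<gamma> \<sigma>)"
    using \<rho> model holds_equiv_closure[OF assms(1)] unfolding models_of_def by blast
qed

lemma models_of_Conj_Neg:
  "models_of M\<^sub>0 (Conj \<phi> (Neg \<chi>)) = models_of M\<^sub>0 \<phi> - models_of M\<^sub>0 \<chi>"
  by (auto simp: models_of_def)

text \<open>The first inclusion makes facts about candidates available for the one being processed;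
  the second reduces Property 1 to Property 2.\<close>

lemma gcg_pending_sol_subset_cand:
  assumes "gcg M\<^sub>0 \<Phi> sat \<psi> g c"
  shows "set_option (pending c) \<subseteq> cand c \<and> sol c \<subseteq> cand c"
  using assms by induction auto

lemma gcg_generalized_excluded:
  assumes "gcg M\<^sub>0 \<Phi> sat \<psi> g c"
  shows "g ` generalized c \<subseteq> excluded c"
  using assms by induction auto

text \<open>Induction over the execution, for any \<open>g\<close> whose formula at a rejected model
  of \<open>\<Phi>\<close> covers the whole class. The third conjunct drives the induction. It
  exempts the pending candidate, which still satisfies \<open>current c\<close> until it is
  processed. The first conjunct keeps every pick a model of \<open>\<Phi>\<close>.\<close>

lemma gcg_candidates_inequivalent:
  assumes "gcg M\<^sub>0 \<Phi> sat \<psi> g c" "is_lts M\<^sub>0"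
    and "\<And>\<sigma>. \<lbrakk>\<sigma> \<in> models_of M\<^sub>0 \<Phi>; \<not> sat (decode M\<^sub>0 \<sigma>) \<psi>\<rbrakk> \<Longrightarrow>
      equiv_class M\<^sub>0 \<Phi> \<sigma> \<subseteq> models_of M\<^sub>0 (g \<sigma>)"
  shows "models_of M\<^sub>0 (current c) \<subseteq> models_of M\<^sub>0 \<Phi> \<and> cand c \<subseteq> models_of M\<^sub>0 \<Phi> \<and>
    (\<forall>\<sigma> \<in> cand c - set_option (pending c). equiv_class M\<^sub>0 \<Phi> \<sigma> \<inter> models_of M\<^sub>0 (current c) = {}) \<and>
    (\<forall>\<sigma> \<in> cand c. \<forall>\<tau> \<in> cand c. assign_equiv M\<^sub>0 \<Phi> \<sigma> \<tau> \<longrightarrow> \<sigma> = \<tau>)"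
  using assms(1)
proof induction
  case start
  then show ?case by simp
next
  case (pick c \<sigma>)
  \<comment> \<open>Nothing is pending before a pick, so the classes of all earlier candidates are
    disjoint from \<open>current c\<close>, which \<open>\<sigma>\<close> satisfies.\<close>
  have "\<sigma> \<notin> equiv_class M\<^sub>0 \<Phi> \<tau>" if "\<tau> \<in> cand c" for \<tau>
    using that pick.IH pick.hyps by auto
  then have "\<not> assign_equiv M\<^sub>0 \<Phi> \<sigma> \<tau>" "\<not> assign_equiv M\<^sub>0 \<Phi> \<tau> \<sigma>" if "\<tau> \<in> cand c" for \<tau>
    using that assign_equiv_sym[of M\<^sub>0 \<Phi> \<tau> \<sigma>] by (auto simp: equiv_class_def)
  with pick show ?case by auto
next
  case (accept c \<sigma>)
  \<comment> \<open>Exactly the class of \<open>\<sigma>\<close> is subtracted; the other classes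
    stay disjoint because \<open>current c\<close> only shrinks.\<close>
  then show ?case
    by (simp add: models_of_Conj_Neg models_of_class_form[OF assms(2)]) blast
next
  case (reject c \<sigma>)
  have "\<sigma> \<in> cand c"
    using gcg_pending_sol_subset_cand[OF reject.hyps(1)] reject.hyps(2) by simp
  then have "equiv_class M\<^sub>0 \<Phi> \<sigma> \<subseteq> models_of M\<^sub>0 (g \<sigma>)"
    using reject.IH reject.hyps(3) assms(3) by blast
  \<comment> \<open>For \<open>\<tau> = \<sigma>\<close>, the exempted candidate, the class is
    covered by \<open>g \<sigma>\<close>; for any other \<open>\<tau>\<close> it was disjoint
    already.\<close>
  then have "equiv_class M\<^sub>0 \<Phi> \<tau> \<inter> (models_of M\<^sub>0 (current c) - models_of M\<^sub>0 (g \<sigma>)) = {}"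
    if "\<tau> \<in> cand c" for \<tau>
    using that reject.IH reject.hyps(2) by (cases "\<tau> = \<sigma>") auto
  moreover have "models_of M\<^sub>0 (current c) - models_of M\<^sub>0 (g \<sigma>) \<subseteq> models_of M\<^sub>0 \<Phi>"
    using reject.IH by blast
  ultimately show ?case
    using reject.IH by (simp add: models_of_Conj_Neg)
qed

lemma one_candidate_per_classI:
  assumes "is_lts M\<^sub>0"
    and "\<And>\<sigma>. \<lbrakk>\<sigma> \<in> models_of M\<^sub>0 \<Phi>; \<not> sat (decode M\<^sub>0 \<sigma>) \<psi>\<rbrakk> \<Longrightarrow>
      equiv_class M\<^sub>0 \<Phi> \<sigma> \<subseteq> models_of M\<^sub>0 (g \<sigma>)"
  shows "one_candidate_per_class M\<^sub>0 \<Phi> sat \<psi> g"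
  unfolding one_candidate_per_class_def
proof (intro allI impI ballI Uniq_I)
  fix c \<rho> \<sigma> \<tau>
  assume c: "gcg M\<^sub>0 \<Phi> sat \<psi> g c \<and> terminated M\<^sub>0 c"
    and \<sigma>\<tau>: "\<sigma> \<in> equiv_class M\<^sub>0 \<Phi> \<rho> \<inter> cand c" "\<tau> \<in> equiv_class M\<^sub>0 \<Phi> \<rho> \<inter> cand c"
  \<comment> \<open>Both are equivalent to the representative \<open>\<rho>\<close>.\<close>
  then have "assign_equiv M\<^sub>0 \<Phi> \<sigma> \<tau>"
    using assign_equiv_sym assign_equiv_trans unfolding equiv_class_def by blast
  with \<sigma>\<tau> show "\<tau> = \<sigma>"
    using gcg_candidates_inequivalent[OF conjunct1[OF c] assms] by blast
qed

lemma one_solution_per_classI: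
  assumes "one_candidate_per_class M\<^sub>0 \<Phi> sat \<psi> g"
  shows "one_solution_per_class M\<^sub>0 \<Phi> sat \<psi> g"
  unfolding one_solution_per_class_def
proof (intro allI impI ballI Uniq_I)
  fix c \<rho> \<sigma> \<tau>
  assume c: "gcg M\<^sub>0 \<Phi> sat \<psi> g c \<and> terminated M\<^sub>0 c" and "\<rho> \<in> models_of M\<^sub>0 \<Phi>"
  then have "\<exists>\<^sub>\<le>\<^sub>1 \<tau>. \<tau> \<in> equiv_class M\<^sub>0 \<Phi> \<rho> \<inter> cand c"
    using assms unfolding one_candidate_per_class_def by blast
  moreover have "sol c \<subseteq> cand c"
    using gcg_pending_sol_subset_cand[OF conjunct1[OF c]] by simp
  moreover assume "\<sigma> \<in> equiv_class M\<^sub>0 \<Phi> \<rho> \<inter> sol c" "\<tau> \<in> equiv_class M\<^sub>0 \<Phi> \<rho> \<inter> sol c"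
  ultimately show "\<tau> = \<sigma>"
    by (blast dest: Uniq_D)
qed

text \<open>If \<open>g\<close> is constant on classes, then \<open>g \<rho>\<close> is the very
  formula \<open>g \<sigma>\<close> that was excluded when \<open>\<sigma>\<close> was rejected, so
  its models are pruned from that step on.\<close>

lemma generalizations_prunedI:
  assumes "\<And>\<rho> \<sigma>. assign_equiv M\<^sub>0 \<Phi> \<rho> \<sigma> \<Longrightarrow> g \<rho> = g \<sigma>"
  shows "generalizations_pruned M\<^sub>0 \<Phi> sat \<psi> g"
  unfolding generalizations_pruned_def
proof (intro allI impI ballI)
  fix c \<sigma> \<rho>
  assume "gcg M\<^sub>0 \<Phi> sat \<psi> g c" "\<sigma> \<in> generalized c" "assign_equiv M\<^sub>0 \<Phi> \<rho> \<sigma>"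
  then have "g \<rho> \<in> excluded c"
    using gcg_generalized_excluded assms by fastforce
  then show "models_of M\<^sub>0 (g \<rho>) \<subseteq> pruned M\<^sub>0 c"
    unfolding pruned_def by blast
qed

theorem theorem5:
  fixes M\<^sub>0 :: "('q, 'a) lts"
    and \<Phi> :: "('q, 'a) var form"
    and sat :: "('q, 'a) lts \<Rightarrow> 's \<Rightarrow> bool"
    and \<psi> :: 's
    and \<gamma> :: "('q, 'a) generalizer"
  assumes "is_lts M\<^sub>0"
    and "vars \<Phi> \<subseteq> variables M\<^sub>0"
    and "\<forall>\<sigma> \<in> models_of M\<^sub>0 \<Phi>. \<forall>t \<in> transitions M\<^sub>0. holds \<sigma> (Atom t)"
    and "\<forall>\<sigma> \<rho>. assign_equiv M\<^sub>0 \<Phi> \<sigma> \<rho> \<longrightarrow>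
           (sat (decode M\<^sub>0 \<sigma>) \<psi> \<longleftrightarrow> sat (decode M\<^sub>0 \<rho>) \<psi>)"
    and "is_generalizer M\<^sub>0 \<gamma>"
    and "proper M\<^sub>0 \<Phi> sat \<psi> \<gamma>"
  shows "one_solution_per_class M\<^sub>0 \<Phi> sat \<psi> (equiv_closure M\<^sub>0 \<Phi> \<gamma>) \<and>
         one_candidate_per_class M\<^sub>0 \<Phi> sat \<psi> (equiv_closure M\<^sub>0 \<Phi> \<gamma>) \<and>
         generalizations_pruned M\<^sub>0 \<Phi> sat \<psi> (equiv_closure M\<^sub>0 \<Phi> \<gamma>)"
proof -
  have "one_candidate_per_class M\<^sub>0 \<Phi> sat \<psi> (equiv_closure M\<^sub>0 \<Phi> \<gamma>)"
    using assms(1) equiv_class_subset_equiv_closure[OF assms(1,4,6)]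
    by (rule one_candidate_per_classI)
  moreover have "generalizations_pruned M\<^sub>0 \<Phi> sat \<psi> (equiv_closure M\<^sub>0 \<Phi> \<gamma>)"
    using equiv_closure_cong by (rule generalizations_prunedI)
  ultimately show ?thesis
    by (simp add: one_solution_per_classI)
qed

end
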